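(* Let $\Omega=\mathbb{R}$ and $\varphi(\cdot)=\psi(\cdot)=|\cdot|$. Let $w\in L^1(\Omega)$, $w\ge0$, be compactly supported in $\Omega$ and such that $\int_\Omega w(x)\,dx=1$. Then $f^*\equiv w$ is the unique solution of the equilibrium condition $$\left|\nabla\mathcal K[f^*](p)\,f^*(p)\right|^2 f^*(p)=0\quad\text{for a.e. }p\in\Omega,\qquad\text{where}\quad \nabla\mathcal K[f](p):=\int_\Omega\left(w(x)-f(x)\right)\operatorname{sign}(p-x)\,dx,$$ in the class $$\mathcal X:=\left\{f\in L^1(\Omega):\ f\ge0\ \text{a.e. on }\Omega,\ \int_\Omega f(x)\,dx=1\right\}.$$
   Context: Here $\mathcal K[f](p)=\int_\Omega(w(x)\varphi(p-x)-f(x)\psi(p-x))\,dx$, and $\nabla\mathcal K[f]$ is understood with the distributional derivative $\varphi'=\psi'=\operatorname{sign}$ inserted, as written in the claim. Elements of $L^1(\Omega)$ are identified up to equality almost everywhere. *)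

theory Defs
  imports "HOL-Analysis.Analysis"
begin

text \<open>Elements of \<open>L\<^sup>1(\<real>)\<close> are represented by Lebesgue-integrable functions \<open>real \<Rightarrow> real\<close>;
  all notions below are invariant under changes on a null set, and equality in \<open>L\<^sup>1\<close> is
  equality almost everywhere.\<close>

definition ess_support :: "(real \<Rightarrow> real) \<Rightarrow> real set" where
  "ess_support w = - \<Union>{U. open U \<and> (AE x in lebesgue. x \<in> U \<longrightarrow> w x = 0)}"

text \<open>The gradient of
  \<open>\<K>[f](p) = \<integral> (w(x) \<phi>(p - x) - f(x) \<psi>(p - x)) dx\<close> for \<open>\<phi> = \<psi> = |\<cdot>|\<close> on \<open>\<real>\<close>, with the
  distributional derivative \<open>\<phi>' = \<psi>' = sgn\<close> inserted.  It is defined by this formula rather than as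
  a derivative of \<open>\<K>[f]\<close>, since \<open>\<K>[f]\<close> itself need not be finite for \<open>f\<close> merely integrable.\<close>

definition grad_K :: "(real \<Rightarrow> real) \<Rightarrow> (real \<Rightarrow> real) \<Rightarrow> real \<Rightarrow> real" where
  "grad_K w f p = (LINT x|lebesgue. (w x - f x) * sgn (p - x))"

definition equilibrium :: "(real \<Rightarrow> real) \<Rightarrow> (real \<Rightarrow> real) \<Rightarrow> bool" where
  "equilibrium w f \<longleftrightarrow> (AE p in lebesgue. \<bar>grad_K w f p * f p\<bar>\<^sup>2 * f p = 0)"

definition class_X :: "(real \<Rightarrow> real) set" where
  "class_X = {f. integrable lebesgue f \<and> (AE x in lebesgue. f x \<ge> 0) \<and>
     (LINT x|lebesgue. f x) = 1}"

end

theory Submission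
  imports Defs
begin

text \<open>Put \<open>G = \<nabla>\<K>[f]\<close>. As \<open>w\<close> and \<open>f\<close> have equal mass, \<open>G\<close> is a continuous function vanishing at
  both infinities, with \<open>G' = 2 (w - f)\<close> almost everywhere. The equilibrium condition forces \<open>f = 0\<close> almost
  everywhere on \<open>{G \<noteq> 0}\<close>, so \<open>G\<close> is nondecreasing on every interval on which it has no zero;
  being zero at both ends of every component of \<open>{G \<noteq> 0}\<close>, it vanishes identically. Hence \<open>w\<close> and
  \<open>f\<close> have the same distribution function.\<close>

text \<open>A positive value at \<open>p\<close> cannot decrease before the next zero to the right.
  So either that first zero has a positive value, or there is no zero and \<open>G\<close> stays
  above \<open>G p\<close> all the way to infinity, against its limit 0.\<close>

lemma nonpos_if_mono_between_zeros:
  fixes G :: "real \<Rightarrow> real"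
  assumes cont: "continuous_on UNIV G"
    and lim: "(G \<longlongrightarrow> 0) at_top"
    and mono: "\<And>a b. a \<le> b \<Longrightarrow> (\<And>x. a < x \<Longrightarrow> x < b \<Longrightarrow> G x \<noteq> 0) \<Longrightarrow> G a \<le> G b"
  shows "G p \<le> 0"
proof (rule ccontr)
  assume "\<not> G p \<le> 0"
  then have pos: "0 < G p" by simp
  show False
  proof (cases "\<exists>x\<ge>p. G x = 0")
    case True
    define Z where "Z = {p..} \<inter> G -` {0}"
    have "closed Z"
      unfolding Z_def using cont by (intro closed_Int closed_vimage) auto
    moreover have "Z \<noteq> {}" "bdd_below Z"
      using True by (auto simp: Z_def)
    \<comment> \<open>The first zero at or after \<open>p\<close>: it is attained because
      \<open>Z\<close> is closed, and nothing strictly between \<open>p\<close> and it is a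
      zero.\<close>
    ultimately have "Inf Z \<in> Z"
      by (simp add: closed_contains_Inf)
    moreover have "G x \<noteq> 0" if "p < x" "x < Inf Z" for x
    proof
      assume "G x = 0"
      then have "x \<in> Z" using that by (simp add: Z_def)
      then show False
        using cInf_lower[OF _ \<open>bdd_below Z\<close>] that by fastforce
    qed
    ultimately have "G p \<le> G (Inf Z)" "G (Inf Z) = 0"
      using mono[of p "Inf Z"] by (auto simp: Z_def)
    then show False using pos by simp
  next
    case False
    then have "G p \<le> G x" if "x \<ge> p" for x
      using mono[of p x] that by fastforce
    then have "\<forall>\<^sub>F x in at_top. G p \<le> G x"
      using eventually_at_top_linorder by blast
    then have "G p \<le> 0"
      using tendsto_lowerbound[OF lim] by simp
    then show False using pos by simp
  qed
qed

lemma zero_if_mono_between_zeros: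
  fixes G :: "real \<Rightarrow> real"
  assumes cont: "continuous_on UNIV G"
    and lim: "(G \<longlongrightarrow> 0) at_top" "(G \<longlongrightarrow> 0) at_bot"
    and mono: "\<And>a b. a \<le> b \<Longrightarrow> (\<And>x. a < x \<Longrightarrow> x < b \<Longrightarrow> G x \<noteq> 0) \<Longrightarrow> G a \<le> G b"
  shows "G p = 0"
proof (rule antisym)
  show "G p \<le> 0"
    using nonpos_if_mono_between_zeros[OF cont lim(1) mono] .
  \<comment> \<open>Replacing \<open>G x\<close> by \<open>- G (- x)\<close> swaps the two
    infinities and reverses the order twice, so the mirrored function is again nondecreasing between
    zeros. Its upper bound at \<open>- p\<close> is the lower bound for \<open>G\<close> at
    \<open>p\<close>.\<close>
  have "- G (- (- p)) \<le> 0"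
  proof (rule nonpos_if_mono_between_zeros[where G = "\<lambda>x. - G (- x)"])
    show "continuous_on UNIV (\<lambda>x. - G (- x))"
      by (intro continuous_intros continuous_on_compose2[OF cont]) auto
    show "((\<lambda>x. - G (- x)) \<longlongrightarrow> 0) at_top"
      using tendsto_minus[OF lim(2)[unfolded filterlim_at_bot_mirror]] by simp
    fix a b :: real
    assume "a \<le> b" and ne: "\<And>x. a < x \<Longrightarrow> x < b \<Longrightarrow> - G (- x) \<noteq> 0"
    have "G x \<noteq> 0" if "- b < x" "x < - a" for x
      using ne[of "- x"] that by simp
    then show "- G (- a) \<le> - G (- b)"
      using mono[of "- b" "- a"] \<open>a \<le> b\<close> by simp
  qed
  then show "0 \<le> G p" by simp
qed

lemma AE_lebesgue_neq: "AE x in lebesgue. x \<noteq> (a::real)"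
  by (intro AE_completion AE_lborel_singleton)

lemma borel_measurable_lebesgue_sgn [measurable]:
  "(\<lambda>x::real. sgn (p - x)) \<in> borel_measurable lebesgue"
  by (rule measurable_completion) simp

lemma integrable_mult_sgn:
  fixes g :: "real \<Rightarrow> real"
  assumes "integrable lebesgue g"
  shows "integrable lebesgue (\<lambda>x. g x * sgn (p - x))"
proof (rule Bochner_Integration.integrable_bound[OF assms])
  show "(\<lambda>x. g x * sgn (p - x)) \<in> borel_measurable lebesgue"
    using assms by measurable
qed (auto simp: abs_mult sgn_if)

text \<open>Dominated convergence with bound \<open>\<bar>g x\<bar>\<close>: for fixed
  \<open>x\<close> the integrand jumps only at \<open>p = x\<close>, so for each limit
  \<open>p\<close> the exceptional set is the single point \<open>x = p\<close>.\<close>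

lemma continuous_on_integral_sgn:
  fixes g :: "real \<Rightarrow> real"
  assumes g: "integrable lebesgue g"
  shows "continuous_on UNIV (\<lambda>p. LINT x|lebesgue. g x * sgn (p - x))"
proof -
  have "(\<lambda>n. LINT x|lebesgue. g x * sgn (u n - x)) \<longlonglongrightarrow> (LINT x|lebesgue. g x * sgn (p - x))"
    if "u \<longlonglongrightarrow> p" for u :: "nat \<Rightarrow> real" and p
  proof (rule integral_dominated_convergence[where w = "\<lambda>x. \<bar>g x\<bar>"])
    show "AE x in lebesgue. (\<lambda>n. g x * sgn (u n - x)) \<longlonglongrightarrow> g x * sgn (p - x)"
      using AE_lebesgue_neq[of p] by eventually_elim (auto intro!: tendsto_intros that)
  qed (use g integrable_mult_sgn[OF g] in \<open>auto simp: abs_mult sgn_if\<close>)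
  then show ?thesis
    by (simp add: continuous_on_sequentially o_def)
qed

lemma tendsto_integral_sgn_at_top:
  fixes g :: "real \<Rightarrow> real"
  assumes g: "integrable lebesgue g"
  shows "((\<lambda>p. LINT x|lebesgue. g x * sgn (p - x)) \<longlongrightarrow> (LINT x|lebesgue. g x)) at_top"
proof (rule integral_dominated_convergence_at_top[where w = "\<lambda>x. \<bar>g x\<bar>"])
  show "AE x in lebesgue. ((\<lambda>p. g x * sgn (p - x)) \<longlongrightarrow> g x) at_top"
  proof (rule AE_I2)
    fix x
    have "\<forall>\<^sub>F p in at_top. g x * sgn (p - x) = g x"
      using eventually_gt_at_top[of x] by eventually_elim simp
    then show "((\<lambda>p. g x * sgn (p - x)) \<longlongrightarrow> g x) at_top"
      by (rule tendsto_eventually)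
  qed
qed (use g integrable_mult_sgn[OF g] in \<open>auto simp: abs_mult sgn_if\<close>)

lemma tendsto_integral_sgn_at_bot:
  fixes g :: "real \<Rightarrow> real"
  assumes g: "integrable lebesgue g"
  shows "((\<lambda>p. LINT x|lebesgue. g x * sgn (p - x)) \<longlongrightarrow> - (LINT x|lebesgue. g x)) at_bot"
  unfolding filterlim_at_bot_mirror integral_minus[symmetric]
proof (rule integral_dominated_convergence_at_top[where w = "\<lambda>x. \<bar>g x\<bar>"])
  show "AE x in lebesgue. ((\<lambda>p. g x * sgn (- p - x)) \<longlongrightarrow> - g x) at_top"
  proof (rule AE_I2)
    fix x
    have "\<forall>\<^sub>F p in at_top. g x * sgn (- p - x) = - g x"
      using eventually_gt_at_top[of "- x"] by eventually_elim simp
    then show "((\<lambda>p. g x * sgn (- p - x)) \<longlongrightarrow> - g x) at_top"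
      by (rule tendsto_eventually)
  qed
qed (use g integrable_mult_sgn[OF g] in \<open>auto simp: abs_mult sgn_if\<close>)

text \<open>Off the endpoints, \<open>sgn (b - x) - sgn (a - x)\<close> is 2 on the open interval
  from \<open>a\<close> to \<open>b\<close> and 0 outside it. This comparison of integrands stands
  in for integrating the derivative \<open>2 * g\<close>, so nothing has to be
  differentiated.\<close>

lemma integral_sgn_mono:
  fixes g :: "real \<Rightarrow> real"
  assumes g: "integrable lebesgue g" and "a \<le> b"
    and nonneg: "AE x in lebesgue. a < x \<longrightarrow> x < b \<longrightarrow> 0 \<le> g x"
  shows "(LINT x|lebesgue. g x * sgn (a - x)) \<le> (LINT x|lebesgue. g x * sgn (b - x))"
proof (rule integral_mono_AE[OF integrable_mult_sgn[OF g] integrable_mult_sgn[OF g]])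
  show "AE x in lebesgue. g x * sgn (a - x) \<le> g x * sgn (b - x)"
    using nonneg AE_lebesgue_neq[of a] AE_lebesgue_neq[of b]
    by eventually_elim (use \<open>a \<le> b\<close> in \<open>auto simp: sgn_if\<close>)
qed

text \<open>The half-lines \<open>{p<..}\<close> determine a Borel measure that is finite on them,
  so the measures with densities \<open>f\<close> and \<open>g\<close> coincide, and a density is
  unique almost everywhere.\<close>

lemma AE_eq_if_tail_integrals_eq:
  fixes f g :: "real \<Rightarrow> real"
  assumes f: "integrable lebesgue f" "AE x in lebesgue. 0 \<le> f x"
    and g: "integrable lebesgue g" "AE x in lebesgue. 0 \<le> g x"
    and eq: "\<And>p. (LINT x|lebesgue. f x * indicator {p<..} x) = (LINT x|lebesgue. g x * indicator {p<..} x)"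
  shows "AE x in lebesgue. f x = g x"
proof -
  \<comment> \<open>A density over \<open>lborel\<close> must be Borel, while \<open>h\<close> is
    only Lebesgue measurable, hence the representative \<open>h'\<close>. Having the value in the
    form \<open>ennreal\<close> of a real number also shows that it is finite.\<close>
  have tail: "emeasure (density lborel (\<lambda>x. ennreal (h' x))) {p<..} =
      ennreal (LINT x|lebesgue. h x * indicator {p<..} x)"
    if h: "integrable lebesgue h" "AE x in lebesgue. 0 \<le> h x"
      and h': "h' \<in> borel_measurable lborel" "AE x in lborel. h x = h' x" for h h' :: "real \<Rightarrow> real" and p
  proof -
    have "emeasure (density lborel (\<lambda>x. ennreal (h' x))) {p<..} =
        (\<integral>\<^sup>+x. ennreal (h' x) * indicator {p<..} x \<partial>lborel)"
      using h' by (intro emeasure_density) auto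
    also have "\<dots> = (\<integral>\<^sup>+x. ennreal (h x * indicator {p<..} x) \<partial>lborel)"
    proof (rule nn_integral_cong_AE)
      show "AE x in lborel. ennreal (h' x) * indicator {p<..} x = ennreal (h x * indicator {p<..} x)"
        using h'(2) by eventually_elim (auto split: split_indicator)
    qed
    also have "\<dots> = (\<integral>\<^sup>+x. ennreal (h x * indicator {p<..} x) \<partial>lebesgue)"
      by (simp add: nn_integral_completion)
    also have "\<dots> = ennreal (LINT x|lebesgue. h x * indicator {p<..} x)"
    proof (rule nn_integral_eq_integral)
      show "integrable lebesgue (\<lambda>x. h x * indicator {p<..} x)"
        using h(1) by (intro integrable_real_mult_indicator) auto
      show "AE x in lebesgue. 0 \<le> h x * indicator {p<..} x"
        using h(2) by eventually_elim auto
    qed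
    finally show ?thesis .
  qed
  obtain f' where f': "f' \<in> borel_measurable lborel" "AE x in lborel. f x = f' x"
    using completion_ex_borel_measurable_real[OF borel_measurable_integrable[OF f(1)]] by blast
  obtain g' where g': "g' \<in> borel_measurable lborel" "AE x in lborel. g x = g' x"
    using completion_ex_borel_measurable_real[OF borel_measurable_integrable[OF g(1)]] by blast
  have "density lborel (\<lambda>x. ennreal (f' x)) = density lborel (\<lambda>x. ennreal (g' x))"
    by (rule measure_eqI_lessThan) (auto simp: tail[OF f f'] tail[OF g g'] eq)
  then have "AE x in lborel. ennreal (f' x) = ennreal (g' x)"
    using f'(1) g'(1) by (intro sigma_finite_measure.density_unique[OF sigma_finite_lborel]) auto
  \<comment> \<open>Since \<open>ennreal\<close> sends every negative number to 0, it can be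
    cancelled only with nonnegativity at hand.\<close>
  moreover have "AE x in lborel. 0 \<le> f x" "AE x in lborel. 0 \<le> g x"
    using f(2) g(2) by (simp_all add: AE_completion_iff)
  ultimately have "AE x in lborel. f x = g x"
    using f'(2) g'(2) by eventually_elim simp
  then show ?thesis by (rule AE_completion)
qed

theorem lemma4:
  fixes w :: "real \<Rightarrow> real"
  assumes "integrable lebesgue w"
    and "AE x in lebesgue. w x \<ge> 0"
    and "compact (ess_support w)"
    and "(LINT x|lebesgue. w x) = 1"
  shows "w \<in> class_X \<and> equilibrium w w \<and>
    (\<forall>f \<in> class_X. equilibrium w f \<longrightarrow> (AE x in lebesgue. f x = w x))"
proof (intro conjI ballI impI)
  show "w \<in> class_X"
    using assms by (simp add: class_X_def)
  show "equilibrium w w"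
    by (simp add: equilibrium_def grad_K_def)
next
  fix f assume "f \<in> class_X" and equi: "equilibrium w f"
  then have f: "integrable lebesgue f" "AE x in lebesgue. 0 \<le> f x" "(LINT x|lebesgue. f x) = 1"
    by (auto simp: class_X_def)
  define g where "g = (\<lambda>x. w x - f x)"
  have g: "integrable lebesgue g" "(LINT x|lebesgue. g x) = 0"
    using assms f by (simp_all add: g_def)
  have G: "grad_K w f = (\<lambda>p. LINT x|lebesgue. g x * sgn (p - x))"
    by (simp add: grad_K_def g_def fun_eq_iff)
  have dichotomy: "AE p in lebesgue. grad_K w f p = 0 \<or> f p = 0"
    using equi unfolding equilibrium_def by eventually_elim simp
  have zero: "grad_K w f p = 0" for p
  proof (rule zero_if_mono_between_zeros[where G = "grad_K w f"])
    show "continuous_on UNIV (grad_K w f)"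
      unfolding G by (rule continuous_on_integral_sgn[OF g(1)])
    show "(grad_K w f \<longlongrightarrow> 0) at_top" "(grad_K w f \<longlongrightarrow> 0) at_bot"
      using tendsto_integral_sgn_at_top[OF g(1)] tendsto_integral_sgn_at_bot[OF g(1)]
      by (simp_all add: G g(2))
    fix a b :: real
    assume "a \<le> b" and ne: "\<And>x. a < x \<Longrightarrow> x < b \<Longrightarrow> grad_K w f x \<noteq> 0"
    \<comment> \<open>Between zeros of the gradient \<open>f\<close> vanishes almost everywhere,
      which leaves \<open>g = w\<close>, and \<open>w\<close> is nonnegative.\<close>
    have "AE x in lebesgue. a < x \<longrightarrow> x < b \<longrightarrow> 0 \<le> g x"
      using dichotomy assms(2) by eventually_elim (use ne in \<open>auto simp: g_def\<close>)
    then show "grad_K w f a \<le> grad_K w f b"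
      unfolding G by (rule integral_sgn_mono[OF g(1) \<open>a \<le> b\<close>])
  qed
  show "AE x in lebesgue. f x = w x"
  proof (rule AE_eq_if_tail_integrals_eq[OF f(1,2) assms(1,2)])
    fix p
    have ind: "integrable lebesgue (\<lambda>x. h x * indicator {p<..} x)"
      if "integrable lebesgue h" for h :: "real \<Rightarrow> real"
      using that by (intro integrable_real_mult_indicator) auto
    \<comment> \<open>Away from \<open>x = p\<close> the indicator of \<open>{p<..}\<close> is
      \<open>(1 - sgn (p - x)) / 2\<close>, so the tail integral of \<open>g\<close> is half its
      total mass minus half the gradient at \<open>p\<close>, and both are 0.\<close>
    have "(LINT x|lebesgue. g x * indicator {p<..} x) = (LINT x|lebesgue. (g x - g x * sgn (p - x)) / 2)"
    proof (rule integral_cong_AE)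
      show "AE x in lebesgue. g x * indicator {p<..} x = (g x - g x * sgn (p - x)) / 2"
        using AE_lebesgue_neq[of p] by eventually_elim (auto simp: sgn_if split: split_indicator)
    qed (use ind[OF g(1)] g(1) integrable_mult_sgn[OF g(1)] in auto)
    also have "\<dots> = 0"
      using zero[of p] g integrable_mult_sgn[OF g(1)] by (simp add: G)
    finally show "(LINT x|lebesgue. f x * indicator {p<..} x) = (LINT x|lebesgue. w x * indicator {p<..} x)"
      using ind[OF f(1)] ind[OF assms(1)] by (simp add: g_def left_diff_distrib)
  qed
qed

end
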